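(* Let $\Bbbk$ be a field and let $A$ be a $2$-dimensional vector space over $\Bbbk$ with basis $x,y$, equipped with the comultiplication (linear map $\Delta\colon A\to A\otimes A$) given by $$\Delta x = x\otimes x,\qquad \Delta y = x\otimes y .$$ Then each of the following bilinear multiplications on $A$ makes $A$ into a non-counital self-distributive bialgebra: a) $x^2=0,\ xy=0,\ yx=0,\ y^2=0$; b) $x^2=x,\ xy=0,\ yx=cy,\ y^2=0$, where $c\in\Bbbk$; c) $x^2=x,\ xy=y,\ yx=0,\ y^2=0$; d) $x^2=x,\ xy=y,\ yx=cx,\ y^2=cy$, where $c\in\Bbbk$; e) $x^2=x,\ xy=y,\ yx=cx-y,\ y^2=dx$, where $c,d\in\Bbbk$; f) $x^2=x,\ xy=y,\ yx=-y,\ y^2=dx$, where $d\in\Bbbk$; g) $x^2=x,\ xy=y,\ yx=cy,\ y^2=0$, where $c\in\Bbbk$; h) $x^2=x,\ xy=cx,\ yx=cx,\ y^2=c^2x$, where $c\in\Bbbk$; k) (if $\operatorname{char}\Bbbk\neq 2$) $x^2=x,\ xy=\frac{c}{2}x,\ yx=cx-y,\ y^2=\frac{c^2}{2}x-\frac{c}{2}y$, where $c\in\Bbbk$; l) $x^2=x,\ xy=y,\ yx=c_1x+c_2y,\ y^2=\frac{-c_1^2c_2}{(1-c_2)^2}x+\frac{c_1(c_2+1)}{1-c_2}y$, where $c_1,c_2\in\Bbbk$, $c_2\neq 1$.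
   Context: Algebras are $\Bbbk$-vector spaces with a bilinear multiplication, not assumed associative or unital. A comultiplication on a vector space $A$ is a linear map $\Delta\colon A\to A\otimes A$; it is coassociative if $(\Delta\otimes\mathrm{id})\circ\Delta=(\mathrm{id}\otimes\Delta)\circ\Delta$. A counit for $(A,\Delta)$ is a linear map $\varepsilon\colon A\to\Bbbk$ with $(\varepsilon\otimes\mathrm{id})\circ\Delta=(\mathrm{id}\otimes\varepsilon)\circ\Delta=\mathrm{id}$ (identifying $\Bbbk\otimes A\cong A\cong A\otimes\Bbbk$). Non-counital means that no counit exists. A bialgebra is a vector space $A$ with a bilinear multiplication and a coassociative comultiplication $\Delta$ such that $\Delta(ab)=\Delta(a)\Delta(b)$ for all $a,b\in A$, where $A\otimes A$ has the component-wise product $(a\otimes b)(a'\otimes b')=aa'\otimes bb'$. In Sweedler notation $\Delta(c)=c^{(1)}\otimes c^{(2)}$ (summation understood), a bialgebra is self-distributive if $(ab)c=(ac^{(1)})(bc^{(2)})$ for all $a,b,c\in A$. *)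

theory Defs
  imports Complex_Main "HOL-Library.Function_Algebras"
begin

text \<open>
  Vector spaces over a field are given by their scalar multiplication, as in the theory
  \<^theory>\<open>HOL.Vector_Spaces\<close>; the underlying space is the whole type.
\<close>

definition bilinear_map ::
  "('k::field \<Rightarrow> 'a::ab_group_add \<Rightarrow> 'a) \<Rightarrow> ('k \<Rightarrow> 'b::ab_group_add \<Rightarrow> 'b) \<Rightarrow>
   ('k \<Rightarrow> 'w::ab_group_add \<Rightarrow> 'w) \<Rightarrow> ('a \<Rightarrow> 'b \<Rightarrow> 'w) \<Rightarrow> bool" where
  "bilinear_map s1 s2 sw f \<longleftrightarrow>
     (\<forall>a. Vector_Spaces.linear s2 sw (f a)) \<and> (\<forall>b. Vector_Spaces.linear s1 sw (\<lambda>a. f a b))"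

definition trilinear_map ::
  "('k::field \<Rightarrow> 'a::ab_group_add \<Rightarrow> 'a) \<Rightarrow> ('k \<Rightarrow> 'w::ab_group_add \<Rightarrow> 'w) \<Rightarrow>
   ('a \<Rightarrow> 'a \<Rightarrow> 'a \<Rightarrow> 'w) \<Rightarrow> bool" where
  "trilinear_map s sw f \<longleftrightarrow>
     (\<forall>a b. Vector_Spaces.linear s sw (\<lambda>c. f a b c)) \<and>
     (\<forall>a c. Vector_Spaces.linear s sw (\<lambda>b. f a b c)) \<and>
     (\<forall>b c. Vector_Spaces.linear s sw (\<lambda>a. f a b c))"

text \<open>
  The tensor square of \<open>A\<close> is constructed inside the dual of the space of bilinear forms on
  \<open>A\<close>: the pure tensor of \<open>a\<close> and \<open>b\<close> is evaluation at \<open>(a, b)\<close>, and \<open>A \<otimes> A\<close> is the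
  space spanned by the pure tensors. Functionals on bilinear forms are encoded as functions on all
  of \<open>'a \<Rightarrow> 'a \<Rightarrow> 'k\<close> that vanish off the bilinear forms. Likewise for \<open>A \<otimes> A \<otimes> A\<close> with
  trilinear forms. The lemmas \<open>bilinear_pure\<close>, \<open>tensor_space_eq_sums\<close>,
  \<open>tensor_lift_sum\<close> and \<open>tensor3_universal\<close> below give the universal properties.
\<close>

type_synonym ('k, 'a) tensor = "('a \<Rightarrow> 'a \<Rightarrow> 'k) \<Rightarrow> 'k"
type_synonym ('k, 'a) tensor3 = "('a \<Rightarrow> 'a \<Rightarrow> 'a \<Rightarrow> 'k) \<Rightarrow> 'k"

definition pure ::
  "('k::field \<Rightarrow> 'a::ab_group_add \<Rightarrow> 'a) \<Rightarrow> 'a \<Rightarrow> 'a \<Rightarrow> ('k, 'a) tensor" where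
  "pure s a b = (\<lambda>\<beta>. if bilinear_map s s (*) \<beta> then \<beta> a b else 0)"

definition pure3 ::
  "('k::field \<Rightarrow> 'a::ab_group_add \<Rightarrow> 'a) \<Rightarrow> 'a \<Rightarrow> 'a \<Rightarrow> 'a \<Rightarrow> ('k, 'a) tensor3" where
  "pure3 s a b c = (\<lambda>\<tau>. if trilinear_map s (*) \<tau> then \<tau> a b c else 0)"

definition tensor_scale :: "'k::field \<Rightarrow> ('x \<Rightarrow> 'k) \<Rightarrow> ('x \<Rightarrow> 'k)" where
  "tensor_scale r t = (\<lambda>\<beta>. r * t \<beta>)"

definition tensor_space :: "('k::field \<Rightarrow> 'a::ab_group_add \<Rightarrow> 'a) \<Rightarrow> ('k, 'a) tensor set" where
  "tensor_space s = module.span tensor_scale {pure s a b | a b. True}"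

text \<open>
  The linear map on \<open>A \<otimes> A\<close> induced by a bilinear map \<open>f\<close>. It sends
  \<open>a\<^sub>1 \<otimes> b\<^sub>1 + \<dots> + a\<^sub>n \<otimes> b\<^sub>n\<close> to \<open>f a\<^sub>1 b\<^sub>1 + \<dots> + f a\<^sub>n b\<^sub>n\<close>, which is how
  expressions in Sweedler notation are evaluated. It is meaningful only for bilinear \<open>f\<close> and
  on \<open>A \<otimes> A\<close>.
\<close>

definition tensor_lift ::
  "('k::field \<Rightarrow> 'a::ab_group_add \<Rightarrow> 'a) \<Rightarrow> ('a \<Rightarrow> 'a \<Rightarrow> 'w::ab_group_add) \<Rightarrow>
   ('k, 'a) tensor \<Rightarrow> 'w" where
  "tensor_lift s f t =
     (THE w. \<exists>ps. t = (\<Sum>(a, b)\<leftarrow>ps. pure s a b) \<and> w = (\<Sum>(a, b)\<leftarrow>ps. f a b))"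

text \<open>The component-wise product on \<open>A \<otimes> A\<close>.\<close>

definition tensor_mult ::
  "('k::field \<Rightarrow> 'a::ab_group_add \<Rightarrow> 'a) \<Rightarrow> ('a \<Rightarrow> 'a \<Rightarrow> 'a) \<Rightarrow>
   ('k, 'a) tensor \<Rightarrow> ('k, 'a) tensor \<Rightarrow> ('k, 'a) tensor" where
  "tensor_mult s m t u =
     tensor_lift s (\<lambda>a b. tensor_lift s (\<lambda>a' b'. pure s (m a a') (m b b')) u) t"

definition comultiplication ::
  "('k::field \<Rightarrow> 'a::ab_group_add \<Rightarrow> 'a) \<Rightarrow> ('a \<Rightarrow> ('k, 'a) tensor) \<Rightarrow> bool" where
  "comultiplication s \<Delta> \<longleftrightarrow>
     Vector_Spaces.linear s tensor_scale \<Delta> \<and> range \<Delta> \<subseteq> tensor_space s"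

text \<open>
  Both iterated comultiplications take values in the threefold tensor product, so the
  identification of \<open>(A \<otimes> A) \<otimes> A\<close> with \<open>A \<otimes> (A \<otimes> A)\<close> is built in.
\<close>

definition comult_tensor_id ::
  "('k::field \<Rightarrow> 'a::ab_group_add \<Rightarrow> 'a) \<Rightarrow> ('a \<Rightarrow> ('k, 'a) tensor) \<Rightarrow>
   ('k, 'a) tensor \<Rightarrow> ('k, 'a) tensor3" where
  "comult_tensor_id s \<Delta> =
     tensor_lift s (\<lambda>a b. tensor_lift s (\<lambda>a\<^sub>1 a\<^sub>2. pure3 s a\<^sub>1 a\<^sub>2 b) (\<Delta> a))"

definition id_tensor_comult ::
  "('k::field \<Rightarrow> 'a::ab_group_add \<Rightarrow> 'a) \<Rightarrow> ('a \<Rightarrow> ('k, 'a) tensor) \<Rightarrow>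
   ('k, 'a) tensor \<Rightarrow> ('k, 'a) tensor3" where
  "id_tensor_comult s \<Delta> =
     tensor_lift s (\<lambda>a b. tensor_lift s (\<lambda>b\<^sub>1 b\<^sub>2. pure3 s a b\<^sub>1 b\<^sub>2) (\<Delta> b))"

definition coassociative ::
  "('k::field \<Rightarrow> 'a::ab_group_add \<Rightarrow> 'a) \<Rightarrow> ('a \<Rightarrow> ('k, 'a) tensor) \<Rightarrow> bool" where
  "coassociative s \<Delta> \<longleftrightarrow> comult_tensor_id s \<Delta> \<circ> \<Delta> = id_tensor_comult s \<Delta> \<circ> \<Delta>"

definition counit ::
  "('k::field \<Rightarrow> 'a::ab_group_add \<Rightarrow> 'a) \<Rightarrow> ('a \<Rightarrow> ('k, 'a) tensor) \<Rightarrow> ('a \<Rightarrow> 'k) \<Rightarrow> bool" where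
  "counit s \<Delta> \<epsilon> \<longleftrightarrow>
     Vector_Spaces.linear s (*) \<epsilon> \<and>
     tensor_lift s (\<lambda>a b. s (\<epsilon> a) b) \<circ> \<Delta> = id \<and>
     tensor_lift s (\<lambda>a b. s (\<epsilon> b) a) \<circ> \<Delta> = id"

definition non_counital ::
  "('k::field \<Rightarrow> 'a::ab_group_add \<Rightarrow> 'a) \<Rightarrow> ('a \<Rightarrow> ('k, 'a) tensor) \<Rightarrow> bool" where
  "non_counital s \<Delta> \<longleftrightarrow> \<not> (\<exists>\<epsilon>. counit s \<Delta> \<epsilon>)"

definition bialgebra ::
  "('k::field \<Rightarrow> 'a::ab_group_add \<Rightarrow> 'a) \<Rightarrow> ('a \<Rightarrow> 'a \<Rightarrow> 'a) \<Rightarrow> ('a \<Rightarrow> ('k, 'a) tensor) \<Rightarrow> bool" where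
  "bialgebra s m \<Delta> \<longleftrightarrow>
     vector_space s \<and> bilinear_map s s s m \<and> comultiplication s \<Delta> \<and> coassociative s \<Delta> \<and>
     (\<forall>a b. \<Delta> (m a b) = tensor_mult s m (\<Delta> a) (\<Delta> b))"

definition self_distributive ::
  "('k::field \<Rightarrow> 'a::ab_group_add \<Rightarrow> 'a) \<Rightarrow> ('a \<Rightarrow> 'a \<Rightarrow> 'a) \<Rightarrow> ('a \<Rightarrow> ('k, 'a) tensor) \<Rightarrow> bool" where
  "self_distributive s m \<Delta> \<longleftrightarrow>
     (\<forall>a b c. m (m a b) c = tensor_lift s (\<lambda>c\<^sub>1 c\<^sub>2. m (m a c\<^sub>1) (m b c\<^sub>2)) (\<Delta> c))"

definition non_counital_sd_bialgebra ::
  "('k::field \<Rightarrow> 'a::ab_group_add \<Rightarrow> 'a) \<Rightarrow> ('a \<Rightarrow> 'a \<Rightarrow> 'a) \<Rightarrow> ('a \<Rightarrow> ('k, 'a) tensor) \<Rightarrow> bool" where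
  "non_counital_sd_bialgebra s m \<Delta> \<longleftrightarrow>
     bialgebra s m \<Delta> \<and> self_distributive s m \<Delta> \<and> non_counital s \<Delta>"

definition mult_table ::
  "('k::field \<Rightarrow> 'a::ab_group_add \<Rightarrow> 'a) \<Rightarrow> 'a \<Rightarrow> 'a \<Rightarrow> 'a \<Rightarrow> 'a \<Rightarrow> 'a \<Rightarrow> 'a \<Rightarrow> ('a \<Rightarrow> 'a \<Rightarrow> 'a) \<Rightarrow> bool" where
  "mult_table s x y xx xy yx yy m \<longleftrightarrow>
     bilinear_map s s s m \<and> m x x = xx \<and> m x y = xy \<and> m y x = yx \<and> m y y = yy"

lemma vector_space_mult: "vector_space ((*) :: 'k::field \<Rightarrow> 'k \<Rightarrow> 'k)"
  by unfold_locales (auto simp: algebra_simps)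

lemma vector_space_tensor_scale: "vector_space (tensor_scale :: 'k::field \<Rightarrow> ('x \<Rightarrow> 'k) \<Rightarrow> _)"
  by unfold_locales (auto simp: tensor_scale_def algebra_simps fun_eq_iff)

lemma functionals_separate:
  fixes sw :: "'k::field \<Rightarrow> 'w::ab_group_add \<Rightarrow> 'w"
  assumes "vector_space sw" and eq: "\<And>\<xi>. Vector_Spaces.linear sw (*) \<xi> \<Longrightarrow> \<xi> v = \<xi> w"
  shows "v = w"
proof (rule ccontr)
  assume "v \<noteq> w"
  interpret vector_space_pair sw "(*) :: 'k \<Rightarrow> 'k \<Rightarrow> 'k"
    using assms(1) vector_space_mult by (simp add: vector_space_pair_def)
  have "vs1.independent {v - w}" using \<open>v \<noteq> w\<close> by (simp add: vs1.dependent_single)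
  then obtain \<xi> where \<xi>: "Vector_Spaces.linear sw (*) \<xi>" "\<forall>u\<in>{v - w}. \<xi> u = (1::'k)"
    using linear_independent_extend[of "{v - w}" "\<lambda>_. 1"] by blast
  then have "\<xi> v - \<xi> w = 1" using linear_diff[OF \<xi>(1), of v w] by simp
  with eq[OF \<xi>(1)] show False by simp
qed

lemma linear_sum_list:
  assumes "Vector_Spaces.linear s1 s2 g"
  shows "g (\<Sum>p\<leftarrow>ps. f p) = (\<Sum>p\<leftarrow>ps. g (f p))"
proof -
  interpret Vector_Spaces.linear s1 s2 g by fact
  show ?thesis by (induction ps) (auto simp: zero add)
qed

lemma sum_list_fun_apply: "(\<Sum>p\<leftarrow>ps. f p) x = (\<Sum>p\<leftarrow>ps. f p x)"
  by (induction ps) auto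

lemma tensor_universal:
  assumes f: "bilinear_map s s sw f"
    and eq: "(\<Sum>(a, b)\<leftarrow>ps. pure s a b) = (\<Sum>(a, b)\<leftarrow>qs. pure s a b)"
  shows "(\<Sum>(a, b)\<leftarrow>ps. f a b) = (\<Sum>(a, b)\<leftarrow>qs. f a b)"
proof (rule functionals_separate[of sw])
  show "vector_space sw"
    using f by (auto simp: bilinear_map_def Vector_Spaces.linear_def)
next
  fix \<xi> assume \<xi>: "Vector_Spaces.linear sw (*) \<xi>"
  have "bilinear_map s s (*) (\<lambda>a b. \<xi> (f a b))"
    using f Vector_Spaces.linear_compose[OF _ \<xi>] by (auto simp: bilinear_map_def o_def)
  moreover have "(\<Sum>(a, b)\<leftarrow>ps. pure s a b) (\<lambda>a b. \<xi> (f a b))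
      = (\<Sum>(a, b)\<leftarrow>qs. pure s a b) (\<lambda>a b. \<xi> (f a b))"
    using eq by simp
  ultimately show "\<xi> (\<Sum>(a, b)\<leftarrow>ps. f a b) = \<xi> (\<Sum>(a, b)\<leftarrow>qs. f a b)"
    by (simp add: linear_sum_list[OF \<xi>] sum_list_fun_apply pure_def case_prod_beta)
qed

lemma tensor_lift_sum:
  assumes "bilinear_map s s sw f"
  shows "tensor_lift s f (\<Sum>(a, b)\<leftarrow>ps. pure s a b) = (\<Sum>(a, b)\<leftarrow>ps. f a b)"
proof -
  have "\<exists>qs. (\<Sum>(a, b)\<leftarrow>ps. pure s a b) = (\<Sum>(a, b)\<leftarrow>qs. pure s a b) \<and>
      (\<Sum>(a, b)\<leftarrow>ps. f a b) = (\<Sum>(a, b)\<leftarrow>qs. f a b)"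
    by (intro exI[of _ ps] conjI refl)
  moreover have "w = (\<Sum>(a, b)\<leftarrow>ps. f a b)"
    if "\<exists>qs. (\<Sum>(a, b)\<leftarrow>ps. pure s a b) = (\<Sum>(a, b)\<leftarrow>qs. pure s a b) \<and>
      w = (\<Sum>(a, b)\<leftarrow>qs. f a b)" for w
  proof -
    from that obtain qs where qs: "(\<Sum>(a, b)\<leftarrow>ps. pure s a b) = (\<Sum>(a, b)\<leftarrow>qs. pure s a b)"
      and w: "w = (\<Sum>(a, b)\<leftarrow>qs. f a b)" by (elim exE conjE)
    show ?thesis unfolding w by (rule tensor_universal[OF assms qs, symmetric])
  qed
  ultimately show ?thesis
    unfolding tensor_lift_def by (intro the_equality)
qed

lemma bilinear_pure:
  assumes "vector_space s"
  shows "bilinear_map s s tensor_scale (pure s)"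
proof -
  interpret vector_space s by fact
  have lin: "Vector_Spaces.linear s (*) (\<beta> a)" "Vector_Spaces.linear s (*) (\<lambda>a. \<beta> a b)"
    if "bilinear_map s s (*) \<beta>" for \<beta> :: "'b \<Rightarrow> 'b \<Rightarrow> 'a" and a b
    using that by (auto simp: bilinear_map_def)
  have "Vector_Spaces.linear s tensor_scale (pure s a)"
    "Vector_Spaces.linear s tensor_scale (\<lambda>a. pure s a b)" for a b
    using lin vector_space_tensor_scale vector_space_axioms
    unfolding Vector_Spaces.linear_iff by (auto simp: pure_def tensor_scale_def fun_eq_iff)
  then show ?thesis by (simp add: bilinear_map_def)
qed

lemma tensor_space_eq_sums:
  assumes "vector_space s"
  shows "tensor_space s = {t. \<exists>ps. t = (\<Sum>(a, b)\<leftarrow>ps. pure s a b)}"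
proof -
  interpret T: vector_space tensor_scale by (rule vector_space_tensor_scale)
  have scale: "tensor_scale r (pure s a b) = pure s (s r a) b" for r a b
    using bilinear_pure[OF assms] by (auto simp: bilinear_map_def Vector_Spaces.linear_iff)
  have "\<exists>ps. t = (\<Sum>(a, b)\<leftarrow>ps. pure s a b)"
    if "t \<in> T.span {pure s a b | a b. True}" for t
    using that
  proof (induction rule: T.span_induct_alt)
    case base
    show ?case by (rule exI[of _ "[]"]) simp
  next
    case (step r u t)
    then obtain a b ps where "u = pure s a b" "t = (\<Sum>(a, b)\<leftarrow>ps. pure s a b)" by blast
    then show ?case by (intro exI[of _ "(s r a, b) # ps"]) (simp add: scale)
  qed
  moreover have "(\<Sum>(a, b)\<leftarrow>ps. pure s a b) \<in> T.span {pure s a b | a b. True}" for ps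
  proof (induction ps)
    case Nil
    show ?case by (simp only: list.map sum_list.Nil T.span_zero)
  next
    case (Cons p ps)
    obtain a b where p: "p = (a, b)" by fastforce
    have "pure s a b \<in> T.span {pure s a b | a b. True}" by (rule T.span_base) blast
    then show ?case unfolding p list.map sum_list.Cons prod.case using Cons by (rule T.span_add)
  qed
  ultimately show ?thesis unfolding tensor_space_def by blast
qed

lemma tensor3_universal:
  assumes f: "trilinear_map s sw f"
    and eq: "(\<Sum>(a, b, c)\<leftarrow>ps. pure3 s a b c) = (\<Sum>(a, b, c)\<leftarrow>qs. pure3 s a b c)"
  shows "(\<Sum>(a, b, c)\<leftarrow>ps. f a b c) = (\<Sum>(a, b, c)\<leftarrow>qs. f a b c)"
proof (rule functionals_separate[of sw])
  show "vector_space sw"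
    using f by (auto simp: trilinear_map_def Vector_Spaces.linear_def)
next
  fix \<xi> assume \<xi>: "Vector_Spaces.linear sw (*) \<xi>"
  have "trilinear_map s (*) (\<lambda>a b c. \<xi> (f a b c))"
    using f Vector_Spaces.linear_compose[OF _ \<xi>] by (auto simp: trilinear_map_def o_def)
  moreover have "(\<Sum>(a, b, c)\<leftarrow>ps. pure3 s a b c) (\<lambda>a b c. \<xi> (f a b c))
      = (\<Sum>(a, b, c)\<leftarrow>qs. pure3 s a b c) (\<lambda>a b c. \<xi> (f a b c))"
    using eq by simp
  ultimately show "\<xi> (\<Sum>(a, b, c)\<leftarrow>ps. f a b c) = \<xi> (\<Sum>(a, b, c)\<leftarrow>qs. f a b c)"
    by (simp add: linear_sum_list[OF \<xi>] sum_list_fun_apply pure3_def case_prod_beta)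
qed

end

theory Submission
  imports Defs
begin

text \<open>
  On the basis, \<open>\<Delta>\<close> agrees with the linear map \<open>z \<mapsto> x \<otimes> z\<close>, so it is this map. With
  \<open>\<Delta> z = x \<otimes> z\<close> every condition becomes elementary. Both iterated comultiplications
  send \<open>z\<close> to \<open>x \<otimes> x \<otimes> z\<close>. Since \<open>\<Delta> a \<Delta> b = xx \<otimes> ab\<close>, compatibility with the
  product holds as soon as \<open>x\<close> is idempotent or the product vanishes. A counit \<open>\<epsilon>\<close> would
  satisfy \<open>z = \<epsilon>(z) x\<close> for every \<open>z\<close>, which is impossible in dimension two. Finally,
  self-distributivity reads \<open>(ab)c = (ax)(bc)\<close>; this reduction is
  \<open>sd_bialgebra_grouplike_left\<close>.

  Both sides of the last identity are trilinear, so it suffices to check the eight triples of basis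
  vectors, and \<open>xx = x\<close> makes two of them trivial. If in addition \<open>xy = y\<close>, then \<open>x\<close> is a
  left unit, and only the triples \<open>(y, y, x)\<close> and \<open>(y, y, y)\<close> remain. In terms of the structure
  constants of \<open>yx\<close> and \<open>yy\<close> they amount to four polynomial equations in the field
  (\<open>left_unit_sd_bialgebra\<close>), which covers six of the ten families.
\<close>

section \<open>Bilinear maps and pure tensors\<close>

lemma tensor_lift_pure:
  assumes "bilinear_map s s sw f"
  shows "tensor_lift s f (pure s a b) = f a b"
  using tensor_lift_sum[OF assms, of "[(a, b)]"] by simp

lemma bilinear_map_iff:
  "bilinear_map s1 s2 sw f \<longleftrightarrow>
     vector_space s1 \<and> vector_space s2 \<and> vector_space sw \<and>
     (\<forall>a b b'. f a (b + b') = f a b + f a b') \<and> (\<forall>a r b. f a (s2 r b) = sw r (f a b)) \<and>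
     (\<forall>a a' b. f (a + a') b = f a b + f a' b) \<and> (\<forall>r a b. f (s1 r a) b = sw r (f a b))"
  unfolding bilinear_map_def Vector_Spaces.linear_iff by blast

lemma trilinear_pure3:
  assumes "vector_space s"
  shows "trilinear_map s tensor_scale (pure3 s)"
proof -
  have rules: "\<tau> a b (c + c') = \<tau> a b c + \<tau> a b c'" "\<tau> a b (s r c) = r * \<tau> a b c"
    "\<tau> a (b + b') c = \<tau> a b c + \<tau> a b' c" "\<tau> a (s r b) c = r * \<tau> a b c"
    "\<tau> (a + a') b c = \<tau> a b c + \<tau> a' b c" "\<tau> (s r a) b c = r * \<tau> a b c"
    if "trilinear_map s (*) \<tau>" for \<tau> :: "'b \<Rightarrow> 'b \<Rightarrow> 'b \<Rightarrow> 'a" and a a' b b' c c' r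
    using that unfolding trilinear_map_def Vector_Spaces.linear_iff by blast+
  show ?thesis
    using vector_space_tensor_scale assms
    unfolding trilinear_map_def[of s tensor_scale] Vector_Spaces.linear_iff
    by (simp add: rules pure3_def tensor_scale_def fun_eq_iff)
qed

section \<open>The comultiplication sending z to the tensor of x and z\<close>

lemma comultiplication_pure_left:
  assumes "vector_space s"
  shows "comultiplication s (pure s x)"
proof -
  interpret T: vector_space tensor_scale by (rule vector_space_tensor_scale)
  have "pure s x z \<in> tensor_space s" for z
    unfolding tensor_space_def by (rule T.span_base) blast
  then show ?thesis
    using bilinear_pure[OF assms] by (auto simp: comultiplication_def bilinear_map_def)
qed

lemma coassociative_pure_left:
  assumes "vector_space s"
  shows "coassociative s (pure s x)"
proof -
  have tri: "trilinear_map s tensor_scale (pure3 s)"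
    by (rule trilinear_pure3[OF assms])
  have bil: "bilinear_map s s tensor_scale (\<lambda>a1 a2. pure3 s a1 a2 b)"
    "bilinear_map s s tensor_scale (pure3 s a)" for a b
    using tri by (auto simp: trilinear_map_def bilinear_map_def)
  have bil': "bilinear_map s s tensor_scale (\<lambda>a b. pure3 s x a b)"
    "bilinear_map s s tensor_scale (\<lambda>a b. pure3 s a x b)"
    using tri by (auto simp: trilinear_map_def bilinear_map_def)
  show ?thesis
    unfolding coassociative_def comult_tensor_id_def id_tensor_comult_def
    by (simp add: fun_eq_iff tensor_lift_pure[OF bil(1)] tensor_lift_pure[OF bil(2)]
        tensor_lift_pure[OF bil'(1)] tensor_lift_pure[OF bil'(2)])
qed

lemma tensor_mult_pure:
  assumes m: "bilinear_map s s s m"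
  shows "tensor_mult s m (pure s a b) (pure s a' b') = pure s (m a a') (m b b')"
proof -
  have vs: "vector_space s" using m by (simp add: bilinear_map_iff)
  note pure = bilinear_pure[OF vs]
  have "bilinear_map s s tensor_scale (\<lambda>a' b'. pure s (m a a') (m b b'))" for a b
    using m pure by (simp add: bilinear_map_iff)
  then have inner: "tensor_lift s (\<lambda>a' b'. pure s (m a a') (m b b')) (pure s a' b')
      = pure s (m a a') (m b b')" for a b
    by (rule tensor_lift_pure)
  have "bilinear_map s s tensor_scale (\<lambda>a b. pure s (m a a') (m b b'))"
    using m pure by (simp add: bilinear_map_iff)
  then show ?thesis
    unfolding tensor_mult_def inner by (rule tensor_lift_pure)
qed

text \<open>
  The right counit law alone already fails: it forces \<open>z = \<epsilon>(z) x\<close> for all \<open>z\<close>.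
\<close>

lemma non_counital_pure_left:
  assumes vs: "vector_space s" and z: "\<And>r. z \<noteq> s r x"
  shows "non_counital s (pure s x)"
proof -
  interpret vector_space s by fact
  have False if "counit s (pure s x) \<epsilon>" for \<epsilon>
  proof -
    from that have lin: "Vector_Spaces.linear s (*) \<epsilon>"
      and right: "tensor_lift s (\<lambda>a b. s (\<epsilon> b) a) \<circ> pure s x = id"
      by (auto simp: counit_def)
    have "bilinear_map s s s (\<lambda>a b. s (\<epsilon> b) a)"
      using lin vs
      by (simp add: bilinear_map_iff Vector_Spaces.linear_iff algebra_simps)
    from tensor_lift_pure[OF this, of x z] right have "s (\<epsilon> z) x = z"
      by (simp add: fun_eq_iff)
    with z show False by metis
  qed
  then show ?thesis by (auto simp: non_counital_def)
qed

text \<open>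
  Substituting \<open>x \<otimes> c\<close> for \<open>\<Delta> c\<close> turns self-distributivity into \<open>dist\<close>. The
  alternatives in \<open>idem\<close> are two ways to make \<open>x \<otimes> ab\<close> equal to \<open>xx \<otimes> ab\<close>,
  and the vector \<open>z\<close> rules out a counit.
\<close>

lemma sd_bialgebra_grouplike_left:
  assumes m: "bilinear_map s s s m"
    and idem: "m x x = x \<or> (\<forall>a b. m a b = 0)"
    and dist: "\<And>a b c. m (m a b) c = m (m a x) (m b c)"
    and z: "\<And>r. z \<noteq> s r x"
  shows "non_counital_sd_bialgebra s m (pure s x)"
proof -
  have vs: "vector_space s" using m by (simp add: bilinear_map_iff)
  interpret vector_space s by fact
  have zero: "pure s a 0 = 0" for a
  proof -
    have "pure s a (s 0 0) = tensor_scale 0 (pure s a 0)"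
      using bilinear_pure[OF vs] unfolding bilinear_map_iff by blast
    then show ?thesis by (simp add: tensor_scale_def fun_eq_iff)
  qed
  have "pure s x (m a b) = tensor_mult s m (pure s x a) (pure s x b)" for a b
    using idem by (auto simp: tensor_mult_pure[OF m] zero)
  then have bialgebra: "bialgebra s m (pure s x)"
    unfolding bialgebra_def
    using vs m comultiplication_pure_left[OF vs] coassociative_pure_left[OF vs] by blast
  have lift: "bilinear_map s s s (\<lambda>c1 c2. m (m a c1) (m b c2))" for a b
    using m by (simp add: bilinear_map_iff)
  have "self_distributive s m (pure s x)"
    unfolding self_distributive_def tensor_lift_pure[OF lift] using dist by blast
  then show ?thesis
    using bialgebra non_counital_pure_left[OF vs z] by (simp add: non_counital_sd_bialgebra_def)
qed

section \<open>Reduction to structure constants\<close>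

locale plane_algebra = vector_space s
  for s :: "'k::field \<Rightarrow> 'a::ab_group_add \<Rightarrow> 'a" +
  fixes x y :: 'a and m :: "'a \<Rightarrow> 'a \<Rightarrow> 'a"
  assumes xy: "x \<noteq> y" "\<not> dependent {x, y}" "span {x, y} = UNIV"
    and bilinear: "bilinear_map s s s m"
begin

lemma mult_linear:
  "m a (b + b') = m a b + m a b'" "m a (s r b) = s r (m a b)"
  "m (a + a') b = m a b + m a' b" "m (s r a) b = s r (m a b)"
  using bilinear by (simp_all add: bilinear_map_iff)

lemma mult_zero: "m a 0 = 0" "m 0 a = 0"
  using mult_linear(2)[of a 0 0] mult_linear(4)[of 0 0 a] by simp_all

lemma mult_neg: "m a (- b) = - m a b" "m (- a) b = - m a b"
  using mult_linear(2)[of a "-1" b] mult_linear(4)[of "-1" a b] by simp_all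

lemma mult_diff: "m a (b - b') = m a b - m a b'" "m (a - a') b = m a b - m a' b"
  using mult_linear(1)[of a b "- b'"] mult_linear(3)[of a "- a'" b] by (simp_all add: mult_neg)

lemma coordinates:
  obtains p q where "v = s p x + s q y"
proof -
  have "v \<in> span {x, y}" using xy(3) by simp
  then show thesis using that by (auto simp: span_insert algebra_simps)
qed

lemma second_basis_vector: "y \<noteq> s r x"
proof
  assume "y = s r x"
  then have "y \<in> span {x}" by (simp add: span_scale span_base)
  moreover have "{x, y} - {y} = {x}" using xy(1) by blast
  ultimately have "dependent {x, y}" unfolding dependent_def by (intro bexI[of _ y]) simp_all
  with xy(2) show False by contradiction
qed

lemma eq_on_basis:
  assumes f: "Vector_Spaces.linear s s f" and g: "Vector_Spaces.linear s s g"
    and "f x = g x" "f y = g y"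
  shows "f v = g v"
proof (rule coordinates[of v])
  fix p q assume "v = s p x + s q y"
  then show ?thesis using assms by (simp add: Vector_Spaces.linear_iff)
qed

text \<open>
  The triples \<open>(x, x, x)\<close> and \<open>(y, x, x)\<close> are absent because they hold by \<open>xx = x\<close>.
\<close>

lemma sd_bialgebra_from_basis:
  assumes xx: "m x x = x"
    and "m x y = m x (m x y)"
    and "m (m x y) x = m x (m y x)"
    and "m (m x y) y = m x (m y y)"
    and "m (m y x) y = m (m y x) (m x y)"
    and "m (m y y) x = m (m y x) (m y x)"
    and "m (m y y) y = m (m y x) (m y y)"
  shows "non_counital_sd_bialgebra s m (pure s x)"
proof (rule sd_bialgebra_grouplike_left[OF bilinear _ _ second_basis_vector])
  show "m x x = x \<or> (\<forall>a b. m a b = 0)" using xx by simp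
  have lin: "Vector_Spaces.linear s s (\<lambda>c. m (m a b) c)"
    "Vector_Spaces.linear s s (\<lambda>c. m (m a x) (m b c))"
    "Vector_Spaces.linear s s (\<lambda>b. m (m a b) c)"
    "Vector_Spaces.linear s s (\<lambda>b. m (m a x) (m b c))"
    "Vector_Spaces.linear s s (\<lambda>a. m (m a b) c)"
    "Vector_Spaces.linear s s (\<lambda>a. m (m a x) (m b c))" for a b c
    by (simp_all add: Vector_Spaces.linear_iff mult_linear vector_space_axioms)
  have basis: "m (m a b) c = m (m a x) (m b c)"
    if "a = x \<or> a = y" "b = x \<or> b = y" "c = x \<or> c = y" for a b c
    using that by (elim disjE) (simp_all only: xx, (rule assms)+)
  have left_middle: "m (m a b) c = m (m a x) (m b c)"
    if "a = x \<or> a = y" "b = x \<or> b = y" for a b c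
    by (rule eq_on_basis[OF lin(1,2)]) (rule basis[OF that], simp)+
  have left: "m (m a b) c = m (m a x) (m b c)" if "a = x \<or> a = y" for a b c
    by (rule eq_on_basis[OF lin(3,4)]) (rule left_middle[OF that], simp)+
  show "m (m a b) c = m (m a x) (m b c)" for a b c
    by (rule eq_on_basis[OF lin(5,6)]) (rule left, simp)+
qed

text \<open>
  The four equations compare the coefficients of \<open>x\<close> and \<open>y\<close> in \<open>(yy)x = (yx)(yx)\<close> and
  in \<open>(yy)y = (yx)(yy)\<close>.
\<close>

lemma left_unit_sd_bialgebra:
  assumes unit: "m x x = x" "m x y = y"
    and yx: "m y x = s p x + s q y" and yy: "m y y = s u x + s v y"
    and eqs: "u + v * p = p^2 + q * p^2 + q^2 * u"
      "v * q = p * q + q^2 * p + q^2 * v"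
      "v * u = p * u + q * u * p + q * v * u"
      "u + v^2 = p * v + q^2 * u + q * v^2"
  shows "non_counital_sd_bialgebra s m (pure s x)"
proof (rule sd_bialgebra_from_basis)
  have left: "m x a = a" for a
    by (rule coordinates[of a]) (simp add: mult_linear unit)
  show "m x x = x" "m x y = m x (m x y)" "m (m x y) x = m x (m y x)"
    "m (m x y) y = m x (m y y)" "m (m y x) y = m (m y x) (m x y)"
    by (simp_all add: left)
  have "m (m y y) x = s (u + v * p) x + s (v * q) y"
    by (simp add: yx yy unit mult_linear algebra_simps)
  also have "\<dots> = m (m y x) (m y x)"
    unfolding eqs(1,2)
    by (simp add: yx yy unit mult_linear algebra_simps power2_eq_square)
  finally show "m (m y y) x = m (m y x) (m y x)" .
  have "m (m y y) y = s (v * u) x + s (u + v^2) y"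
    by (simp add: yx yy unit mult_linear algebra_simps power2_eq_square)
  also have "\<dots> = m (m y x) (m y y)"
    unfolding eqs(3,4)
    by (simp add: yx yy unit mult_linear algebra_simps power2_eq_square)
  finally show "m (m y y) y = m (m y x) (m y y)" .
qed

end

section \<open>The ten families\<close>

text \<open>
  The fractions arise by solving the equations of \<open>left_unit_sd_bialgebra\<close>: when
  \<open>q\<close> is none of \<open>0, 1, -1\<close>, the second equation determines \<open>v\<close> and then the first one
  determines \<open>u\<close>.
\<close>

lemma left_unit_generic_solution:
  fixes p q u v :: "'k::field"
  assumes q: "q \<noteq> 1"
    and u: "u = - (p^2) * q / (1 - q)^2" and v: "v = p * (q + 1) / (1 - q)"
  shows "u + v * p = p^2 + q * p^2 + q^2 * u"
    "v * q = p * q + q^2 * p + q^2 * v"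
    "v * u = p * u + q * u * p + q * v * u"
    "u + v^2 = p * v + q^2 * u + q * v^2"
proof -
  \<comment> \<open>Measured in units of \<open>p / (1 - q)\<close>, all quantities become polynomials in \<open>q\<close>.\<close>
  define w where "w = p / (1 - q)"
  have p: "p = w * (1 - q)" using q by (simp add: w_def)
  have u': "u = - (w^2) * q" using q by (simp add: u w_def power_divide)
  have v': "v = w * (q + 1)" by (simp add: v w_def)
  show "u + v * p = p^2 + q * p^2 + q^2 * u"
    "v * q = p * q + q^2 * p + q^2 * v"
    "v * u = p * u + q * u * p + q * v * u"
    "u + v^2 = p * v + q^2 * u + q * v^2"
    unfolding u' v' p by (simp_all add: algebra_simps power2_eq_square)
qed

lemma two_neq_zero_if_CHAR_neq_2:
  assumes "CHAR('k::field) \<noteq> 2"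
  shows "(2::'k) \<noteq> 0"
proof
  assume "(2::'k) = 0"
  then have "of_nat 2 = (0::'k)" by simp
  then have "CHAR('k) dvd 2" by (simp only: of_nat_eq_0_iff_char_dvd)
  then have "CHAR('k) = 1 \<or> CHAR('k) = 2"
    by (metis dvd_imp_le le_neq_implies_less less_2_cases_iff pos2 dvd_0_left_iff
        zero_neq_numeral One_nat_def)
  with assms show False by simp
qed

theorem proposition3p4:
  fixes s :: "'k::field \<Rightarrow> 'a::ab_group_add \<Rightarrow> 'a"
    and x y :: 'a
    and \<Delta> :: "'a \<Rightarrow> ('k, 'a) tensor"
    and m :: "'a \<Rightarrow> 'a \<Rightarrow> 'a"
  assumes "vector_space s"
    and "x \<noteq> y" and "\<not> module.dependent s {x, y}" and "module.span s {x, y} = UNIV"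
    and "comultiplication s \<Delta>"
    and "\<Delta> x = pure s x x" and "\<Delta> y = pure s x y"
  shows "(mult_table s x y 0 0 0 0 m \<longrightarrow> non_counital_sd_bialgebra s m \<Delta>) \<and>
    (\<forall>c. mult_table s x y x 0 (s c y) 0 m \<longrightarrow> non_counital_sd_bialgebra s m \<Delta>) \<and>
    (mult_table s x y x y 0 0 m \<longrightarrow> non_counital_sd_bialgebra s m \<Delta>) \<and>
    (\<forall>c. mult_table s x y x y (s c x) (s c y) m \<longrightarrow> non_counital_sd_bialgebra s m \<Delta>) \<and>
    (\<forall>c d. mult_table s x y x y (s c x - y) (s d x) m \<longrightarrow> non_counital_sd_bialgebra s m \<Delta>) \<and>
    (\<forall>d. mult_table s x y x y (- y) (s d x) m \<longrightarrow> non_counital_sd_bialgebra s m \<Delta>) \<and>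
    (\<forall>c. mult_table s x y x y (s c y) 0 m \<longrightarrow> non_counital_sd_bialgebra s m \<Delta>) \<and>
    (\<forall>c. mult_table s x y x (s c x) (s c x) (s (c^2) x) m \<longrightarrow> non_counital_sd_bialgebra s m \<Delta>) \<and>
    (CHAR('k) \<noteq> 2 \<longrightarrow>
      (\<forall>c. mult_table s x y x (s (c / 2) x) (s c x - y) (s (c^2 / 2) x - s (c / 2) y) m \<longrightarrow>
        non_counital_sd_bialgebra s m \<Delta>)) \<and>
    (\<forall>c\<^sub>1 c\<^sub>2. c\<^sub>2 \<noteq> 1 \<longrightarrow>
      mult_table s x y x y (s c\<^sub>1 x + s c\<^sub>2 y)
        (s (- (c\<^sub>1^2) * c\<^sub>2 / (1 - c\<^sub>2)^2) x + s (c\<^sub>1 * (c\<^sub>2 + 1) / (1 - c\<^sub>2)) y) m \<longrightarrow>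
      non_counital_sd_bialgebra s m \<Delta>)"
proof -
  have \<Delta>: "\<Delta> = pure s x"
  proof
    fix z
    have lin: "Vector_Spaces.linear s tensor_scale \<Delta>"
      "Vector_Spaces.linear s tensor_scale (pure s x)"
      using assms(5) bilinear_pure[OF assms(1)]
      by (auto simp: comultiplication_def bilinear_map_def)
    interpret vector_space_pair s tensor_scale
      using assms(1) vector_space_tensor_scale by (rule vector_space_pair.intro)
    show "\<Delta> z = pure s x z"
      by (rule linear_eq_on_span[OF lin, of "{x, y}"]) (use assms in auto)
  qed
  have plane: "plane_algebra s x y m" if "mult_table s x y xx xy yx yy m" for xx xy yx yy
    using that assms(1-4)
    by (simp add: plane_algebra_def plane_algebra_axioms_def mult_table_def)
  have table: "m x x = xx" "m x y = xy" "m y x = yx" "m y y = yy"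
    if "mult_table s x y xx xy yx yy m" for xx xy yx yy
    using that by (simp_all add: mult_table_def)
  interpret vector_space s by (rule assms(1))

  have a: "non_counital_sd_bialgebra s m \<Delta>" if t: "mult_table s x y 0 0 0 0 m"
  proof -
    interpret plane_algebra s x y m by (rule plane[OF t])
    have "m a b = 0" for a b
      by (rule coordinates[of a], rule coordinates[of b]) (simp add: mult_linear table[OF t])
    then show ?thesis
      unfolding \<Delta> by (intro sd_bialgebra_grouplike_left[OF bilinear _ _ second_basis_vector]) simp_all
  qed
  have b: "non_counital_sd_bialgebra s m \<Delta>" if t: "mult_table s x y x 0 (s c y) 0 m" for c
  proof -
    interpret plane_algebra s x y m by (rule plane[OF t])
    show ?thesis
      unfolding \<Delta> by (rule sd_bialgebra_from_basis) (simp_all add: table[OF t] mult_linear mult_zero)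
  qed
  have unit: "non_counital_sd_bialgebra s m \<Delta>"
    if t: "mult_table s x y x y (s p x + s q y) (s u x + s v y) m"
      and eqs: "u + v * p = p^2 + q * p^2 + q^2 * u"
      "v * q = p * q + q^2 * p + q^2 * v"
      "v * u = p * u + q * u * p + q * v * u"
      "u + v^2 = p * v + q^2 * u + q * v^2" for p q u v
  proof -
    interpret plane_algebra s x y m by (rule plane[OF t])
    show ?thesis
      unfolding \<Delta> by (rule left_unit_sd_bialgebra[OF table[OF t] eqs])
  qed
  have c: "non_counital_sd_bialgebra s m \<Delta>" if "mult_table s x y x y 0 0 m"
    using unit[of 0 0 0 0] that by simp
  have d: "non_counital_sd_bialgebra s m \<Delta>" if "mult_table s x y x y (s c x) (s c y) m" for c
    using unit[of c 0 0 c] that by (simp add: power2_eq_square)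
  have e: "non_counital_sd_bialgebra s m \<Delta>"
    if "mult_table s x y x y (s c x - y) (s d x) m" for c d
    using unit[of c "-1" d 0] that by simp
  have f: "non_counital_sd_bialgebra s m \<Delta>" if "mult_table s x y x y (- y) (s d x) m" for d
    using e[of 0 d] that by simp
  have g: "non_counital_sd_bialgebra s m \<Delta>" if "mult_table s x y x y (s c y) 0 m" for c
    using unit[of 0 c 0 0] that by simp
  have h: "non_counital_sd_bialgebra s m \<Delta>"
    if t: "mult_table s x y x (s c x) (s c x) (s (c^2) x) m" for c
  proof -
    interpret plane_algebra s x y m by (rule plane[OF t])
    show ?thesis
      unfolding \<Delta>
      by (rule sd_bialgebra_from_basis)
        (simp_all add: table[OF t] mult_linear power2_eq_square algebra_simps)
  qed
  have k: "non_counital_sd_bialgebra s m \<Delta>"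
    if char: "CHAR('k) \<noteq> 2"
      and t: "mult_table s x y x (s (c / 2) x) (s c x - y) (s (c^2 / 2) x - s (c / 2) y) m" for c
  proof -
    interpret plane_algebra s x y m by (rule plane[OF t])
    \<comment> \<open>In terms of half of \<open>c\<close> the structure constants are polynomial.\<close>
    define h where "h = c / 2"
    have two: "(2::'k) \<noteq> 0" by (rule two_neq_zero_if_CHAR_neq_2[OF char])
    have c2: "c = 2 * h" using two by (simp add: h_def)
    have "c^2 / 2 = 2 * (h * h)" unfolding c2 using two by (simp add: power2_eq_square)
    then have sq: "c^2 / 2 = h * h + h * h" by (simp only: mult_2)
    have half: "c / 2 = h" by (simp only: h_def)
    have double: "c = h + h" unfolding c2 by (rule mult_2)
    have products: "m x y = s h x" "m y x = s (h + h) x - y" "m y y = s (h * h + h * h) x - s h y"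
      by (rule table[OF t[unfolded half sq, unfolded double]])+
    have twice: "s r v + s r v = s (r * 2) v" for r v
      by (simp only: mult_2_right scale_left_distrib)
    show ?thesis
      unfolding \<Delta>
      by (rule sd_bialgebra_from_basis)
        (simp_all add: products twice table(1)[OF t] mult_linear mult_diff algebra_simps)
  qed
  have l: "non_counital_sd_bialgebra s m \<Delta>"
    if "c2 \<noteq> 1" "mult_table s x y x y (s c1 x + s c2 y)
      (s (- (c1^2) * c2 / (1 - c2)^2) x + s (c1 * (c2 + 1) / (1 - c2)) y) m" for c1 c2
    using that(2) left_unit_generic_solution[OF that(1) refl refl] by (rule unit)
  show ?thesis
    using a b c d e f g h k l by blast
qed

end
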